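(* Let $f : \mathbb{R}^d \to \mathbb{R}$ be an $(L_0, L_1)$-smooth function, and let $(x_t)_{t \in \mathbb{N}}$ be Clip-SGD iterates on $f$ with clipping constant $c > 0$, stepsize $\eta > 0$, and variance bound $\sigma^2 \in \mathbb{R}_+$ (with $\sigma \geq 0$). Define $\bar\beta = L_0 + c L_1$. If $\eta \bar\beta \leq 1$, then for all $t \in \mathbb{N}$, $$ \mathbb{E}[f(x_{t+1}) \mid x_t] - f(x_t) \leq -\frac{\eta}{2} \left(1 - \eta \bar\beta \right) \alpha_t \lVert \nabla f(x_t) \rVert_2^2 + \frac{\eta^2 \bar\beta}{2} \min(\sigma^2, c^2) + \eta \kappa, $$ where $\alpha_t = \min\left(1, c / \lVert \nabla f(x_t) \rVert_2\right)$, $\varepsilon_0 = 4 \min(\sigma, \sigma^2/c)$, and $\kappa = \varepsilon_0 \min(\varepsilon_0 / 8, 2 c) \leq \frac{1}{8} \varepsilon_0^2$.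
   Context: A differentiable function $f : \mathbb{R}^d \to \mathbb{R}$ is $(L_0, L_1)$-smooth (with $L_0, L_1 \geq 0$) if for all $x, y \in \mathbb{R}^d$ with $\lVert x - y \rVert_2 \leq 1/L_1$ it holds that $\lVert \nabla f(x) - \nabla f(y) \rVert_2 \leq (L_0 + \lVert \nabla f(x) \rVert_2 L_1) \lVert x - y \rVert_2$. If $L_1 = 0$, $1/L_1$ is read as $+\infty$. For $c > 0$, $\mathrm{P}_c : \mathbb{R}^d \to \mathbb{R}^d$, $\mathrm{P}_c(v) = \min(1, c/\lVert v \rVert_2) \, v$, is the Euclidean projection onto $\{ x \in \mathbb{R}^d : \lVert x \rVert_2 \leq c \}$. The convention is $\min(1, c/0) = 1$. Clip-SGD iterates on $f$ with clipping constant $c > 0$, stepsize $\eta > 0$ and variance bound $\sigma^2$ form a random sequence with $x_{t+1} = x_t - \eta \, \mathrm{P}_c(\nabla f_\xi(x_t))$. Here $\xi$ is a fresh random sample drawn at each step independently of the past, and $\nabla f_\xi(x) \in \mathbb{R}^d$ denotes a stochastic gradient estimate (jointly measurable in $(x,\xi)$) satisfying, for every $x \in \mathbb{R}^d$, $\mathbb{E}_\xi[\nabla f_\xi(x)] = \nabla f(x)$ and $\mathbb{E}_\xi[\lVert \nabla f_\xi(x) - \nabla f(x) \rVert_2^2] \leq \sigma^2$. *)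

theory Defs
  imports "HOL-Probability.Probability"
begin

definition gradient :: "('a::euclidean_space \<Rightarrow> real) \<Rightarrow> 'a \<Rightarrow> 'a" where
  "gradient f x = (THE D. GDERIV f x :> D)"

lemma gradient_eqI:
  assumes "GDERIV f x :> D"
  shows "gradient f x = D"
  unfolding gradient_def
proof (rule the_equality)
  show "GDERIV f x :> D" by (rule assms)
next
  fix D' assume "GDERIV f x :> D'"
  with assms have "(\<lambda>h. h \<bullet> D') = (\<lambda>h. h \<bullet> D)"
    unfolding gderiv_def by (metis has_derivative_unique)
  then show "D' = D"
    by (metis vector_eq_ldot)
qed

lemma GDERIV_gradient:
  assumes "f differentiable (at x)"
  shows "GDERIV f x :> gradient f x"
proof -
  obtain f' where f': "(f has_derivative f') (at x)"
    using assms unfolding differentiable_def by blast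
  then interpret f': linear f'
    by (rule has_derivative_linear)
  define D where "D = (\<Sum>b\<in>Basis. f' b *\<^sub>R b)"
  have "f' h = h \<bullet> D" for h
  proof -
    have "f' h = f' (\<Sum>b\<in>Basis. (h \<bullet> b) *\<^sub>R b)"
      by (simp add: euclidean_representation)
    also have "\<dots> = h \<bullet> D"
      by (simp add: D_def f'.sum f'.scale inner_sum_right mult.commute)
    finally show ?thesis .
  qed
  then have "f' = (\<lambda>h. h \<bullet> D)"
    by blast
  with f' have "GDERIV f x :> D"
    by (simp add: gderiv_def)
  then show ?thesis
    using gradient_eqI by metis
qed

text \<open>The radius \<open>1 / L\<^sub>1\<close> is infinite for \<open>L\<^sub>1 = 0\<close>, whereas \<open>1 / 0 = 0\<close> in HOL;
  hence the explicit disjunction.\<close>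

definition L0_L1_smooth :: "real \<Rightarrow> real \<Rightarrow> ('a::euclidean_space \<Rightarrow> real) \<Rightarrow> bool" where
  "L0_L1_smooth L0 L1 f \<longleftrightarrow>
     0 \<le> L0 \<and> 0 \<le> L1 \<and>
     (\<forall>x. f differentiable (at x)) \<and>
     (\<forall>x y. L1 = 0 \<or> norm (x - y) \<le> 1 / L1 \<longrightarrow>
        norm (gradient f x - gradient f y) \<le> (L0 + norm (gradient f x) * L1) * norm (x - y))"

text \<open>The factor \<open>min 1 (c / norm v)\<close>, with the convention that it is \<open>1\<close> at \<open>v = 0\<close>
  (where \<open>c / norm v = 0\<close> in HOL).\<close>

definition clip_factor :: "real \<Rightarrow> 'a::euclidean_space \<Rightarrow> real" where
  "clip_factor c v = (if v = 0 then 1 else min 1 (c / norm v))"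

definition clip :: "real \<Rightarrow> 'a::euclidean_space \<Rightarrow> 'a" where
  "clip c v = clip_factor c v *\<^sub>R v"

text \<open>\<open>D\<close> is the law of a sample \<open>\<xi>\<close> and \<open>g x \<xi>\<close> is the gradient estimate at \<open>x\<close>. Integrability
  is required explicitly because the Bochner integral of a non-integrable function is \<open>0\<close>.\<close>

definition stochastic_gradient ::
    "'s measure \<Rightarrow> ('a::euclidean_space \<Rightarrow> real) \<Rightarrow> real \<Rightarrow> ('a \<Rightarrow> 's \<Rightarrow> 'a) \<Rightarrow> bool" where
  "stochastic_gradient D f \<sigma> g \<longleftrightarrow>
     prob_space D \<and>
     (\<lambda>(x, s). g x s) \<in> borel_measurable (borel \<Otimes>\<^sub>M D) \<and>
     (\<forall>x. integrable D (g x) \<and> (LINT s|D. g x s) = gradient f x) \<and>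
     (\<forall>x. integrable D (\<lambda>s. (norm (g x s - gradient f x))\<^sup>2) \<and>
          (LINT s|D. (norm (g x s - gradient f x))\<^sup>2) \<le> \<sigma>\<^sup>2)"

text \<open>The events before step \<open>t\<close>: those determined by \<open>x\<^sub>0, \<dots>, x\<^sub>t\<close> and
  \<open>\<xi>\<^sub>0, \<dots>, \<xi>\<^sub>t\<^sub>-\<^sub>1\<close>.\<close>

definition past ::
    "'w measure \<Rightarrow> 's measure \<Rightarrow> (nat \<Rightarrow> 'w \<Rightarrow> 'a::euclidean_space) \<Rightarrow> (nat \<Rightarrow> 'w \<Rightarrow> 's) \<Rightarrow> nat \<Rightarrow>
     'w set set" where
  "past M D x \<xi> t = sigma_sets (space M)
     ({x s -` A \<inter> space M | s A. s \<le> t \<and> A \<in> sets borel} \<union>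
      {\<xi> s -` A \<inter> space M | s A. s < t \<and> A \<in> sets D})"

text \<open>\<open>\<xi> t\<close> is the sample drawn at step \<open>t\<close>; the initial point \<open>x 0\<close> may be random.\<close>

definition clip_sgd ::
    "'w measure \<Rightarrow> 's measure \<Rightarrow> ('a::euclidean_space \<Rightarrow> real) \<Rightarrow> real \<Rightarrow> real \<Rightarrow> real \<Rightarrow>
     ('a \<Rightarrow> 's \<Rightarrow> 'a) \<Rightarrow> (nat \<Rightarrow> 'w \<Rightarrow> 's) \<Rightarrow> (nat \<Rightarrow> 'w \<Rightarrow> 'a) \<Rightarrow> bool" where
  "clip_sgd M D f c \<eta> \<sigma> g \<xi> x \<longleftrightarrow>
     prob_space M \<and>
     stochastic_gradient D f \<sigma> g \<and>
     x 0 \<in> borel_measurable M \<and>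
     (\<forall>t. \<xi> t \<in> measurable M D \<and> distr M D (\<xi> t) = D) \<and>
     (\<forall>t. prob_space.indep_set M (past M D x \<xi> t) {\<xi> t -` A \<inter> space M | A. A \<in> sets D}) \<and>
     (\<forall>t. \<forall>\<omega>\<in>space M. x (Suc t) \<omega> = x t \<omega> - \<eta> *\<^sub>R clip c (g (x t \<omega>) (\<xi> t \<omega>)))"

end

theory Submission
  imports Defs
begin

text \<open>Write \<open>G\<close> for the gradient at \<open>x\<^sub>t\<close>, \<open>p = \<alpha> G\<close> for its clipping, \<open>v\<close> for the clipped
  estimate and \<open>\<theta> = \<eta> \<beta>\<close>. Since \<open>\<alpha> (L\<^sub>0 + \<parallel>G\<parallel> L\<^sub>1) \<le> \<beta>\<close>, the descent inequality along the
  step, multiplied by \<open>\<alpha>\<close>, becomes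
  \<open>\<alpha> (f (x - \<eta> v) - f x) \<le> \<eta> ((1 - \<theta>) (- \<langle>p, v\<rangle>) + \<theta> (\<parallel>v\<parallel>\<^sup>2 / 2 - \<langle>p, v\<rangle>))\<close>.
  It remains to bound \<open>\<parallel>p\<parallel>\<^sup>2 / 2 - \<langle>p, E v\<rangle>\<close> by \<open>\<alpha> \<kappa>\<close> and \<open>E \<parallel>v\<parallel>\<^sup>2 / 2 - \<langle>p, E v\<rangle>\<close> by
  \<open>\<alpha> (min \<sigma>\<^sup>2 c\<^sup>2 / 2 + \<kappa>)\<close>. For \<open>\<parallel>G\<parallel> < c\<close> this uses that clipping is nonexpansive and moves an
  estimate \<open>g\<close> by at most \<open>\<parallel>g - G\<parallel>\<^sup>2 / (4 (c - \<parallel>G\<parallel>))\<close>; for \<open>\<parallel>G\<parallel> \<ge> c\<close> it uses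
  \<open>\<parallel>v - p\<parallel> \<le> 2 \<alpha> \<parallel>g - G\<parallel>\<close> and \<open>\<parallel>v\<parallel>\<^sup>2 / 2 - \<langle>p, v\<rangle> \<le> \<alpha> \<parallel>g - G\<parallel>\<^sup>2 / 2\<close>.
  Conditioning on \<open>x\<^sub>t\<close> freezes it, because the fresh sample is independent of it.\<close>

subsection \<open>Clipping\<close>

lemma clip_factor_pos: "c > 0 \<Longrightarrow> 0 < clip_factor c v"
  and clip_factor_le_1: "clip_factor c v \<le> 1"
  by (auto simp: clip_factor_def)

lemma clip_factor_small: "norm v \<le> c \<Longrightarrow> clip_factor c v = 1"
  by (auto simp: clip_factor_def)

lemma clip_factor_large: "0 < c \<Longrightarrow> c \<le> norm v \<Longrightarrow> clip_factor c v = c / norm v"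
  by (auto simp: clip_factor_def)

lemma norm_clip: "c > 0 \<Longrightarrow> norm (clip c v) = min (norm v) c"
  by (auto simp: clip_def clip_factor_def min_def field_simps)

lemma norm_clip_diff:
  assumes "c > 0"
  shows "norm (v - clip c v) = max 0 (norm v - c)"
proof -
  have "v - clip c v = (1 - clip_factor c v) *\<^sub>R v"
    by (simp add: clip_def scaleR_diff_left)
  then have "norm (v - clip c v) = (1 - clip_factor c v) * norm v"
    using clip_factor_le_1[of c v] by simp
  also have "\<dots> = max 0 (norm v - c)"
    using assms by (auto simp: clip_factor_def min_def max_def field_simps)
  finally show ?thesis .
qed

text \<open>Identifying clipping with projection onto a closed convex set gives access to
  nonexpansiveness and continuity.\<close>

lemma clip_eq_closest_point:
  assumes "c > 0"
  shows "clip c v = closest_point (cball 0 c) v"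
proof (rule closest_point_unique)
  show "clip c v \<in> cball 0 c"
    using assms by (simp add: norm_clip)
  show "\<forall>z\<in>cball 0 c. dist v (clip c v) \<le> dist v z"
  proof
    fix z :: 'a assume "z \<in> cball 0 c"
    then have "norm v - c \<le> norm (v - z)"
      using norm_triangle_ineq2[of v z] by simp
    then show "dist v (clip c v) \<le> dist v z"
      using assms by (simp add: dist_norm norm_clip_diff)
  qed
qed simp_all

lemma clip_nonexpansive: "c > 0 \<Longrightarrow> norm (clip c v - clip c w) \<le> norm (v - w)"
  using closest_point_lipschitz[of "cball 0 c" v w]
  by (simp add: clip_eq_closest_point dist_norm)

lemma borel_measurable_clip [measurable]:
  assumes "c > 0"
  shows "(clip c :: 'a::euclidean_space \<Rightarrow> 'a) \<in> borel_measurable borel"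
proof -
  have "(clip c :: 'a \<Rightarrow> 'a) = closest_point (cball 0 c)"
    using assms by (intro ext clip_eq_closest_point)
  moreover have "continuous_on UNIV (closest_point (cball (0::'a) c))"
    using assms by (intro continuous_on_closest_point) simp_all
  ultimately show ?thesis
    by (simp add: borel_measurable_continuous_onI)
qed

text \<open>Going through \<open>\<alpha> *\<^sub>R v\<close>, with \<open>\<alpha>\<close> the
  factor of \<open>G\<close>, costs at most \<open>\<alpha> * norm (v - G)\<close> on either side.
  The factor \<open>\<alpha>\<close> is essential because the descent estimate is finally divided by
  it.\<close>

lemma clip_diff_le_relative:
  assumes "c > 0" "c \<le> norm G"
  shows "norm (clip c v - clip c G) \<le> 2 * clip_factor c G * norm (v - G)"
proof -
  define \<alpha> where "\<alpha> = clip_factor c G"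
  have R: "norm G > 0"
    using assms by linarith
  have \<alpha>: "\<alpha> = c / norm G" "\<alpha> \<le> 1" "\<alpha> > 0"
    using assms clip_factor_large[of c G] clip_factor_le_1[of c G] clip_factor_pos[of c G]
    unfolding \<alpha>_def by blast+
  have "norm (clip c v - \<alpha> *\<^sub>R v) = \<bar>clip_factor c v - \<alpha>\<bar> * norm v"
    by (simp add: clip_def flip: scaleR_diff_left)
  also have "\<dots> \<le> \<alpha> * \<bar>norm v - norm G\<bar>"
  proof (cases "norm v \<le> c")
    case True
    \<comment> \<open>Rearranged, this is \<open>norm v \<le> \<alpha> * norm G\<close>, whose
      right-hand side equals \<open>c\<close>.\<close>
    have "(1 - \<alpha>) * norm v \<le> \<alpha> * (norm G - norm v)"
      using True R by (simp add: \<alpha>(1) field_simps)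
    then show ?thesis
      using True assms(2) \<alpha>(2) by (simp add: clip_factor_small)
  next
    case False
    then have "clip_factor c v * norm v = \<alpha> * norm G"
      using assms R by (auto simp: clip_factor_large \<alpha>(1))
    then have "\<bar>clip_factor c v - \<alpha>\<bar> * norm v = \<bar>\<alpha> * norm G - \<alpha> * norm v\<bar>"
      by (metis abs_mult abs_norm_cancel left_diff_distrib)
    also have "\<dots> = \<alpha> * \<bar>norm v - norm G\<bar>"
      using \<alpha>(3) by (simp add: abs_minus_commute abs_mult flip: right_diff_distrib)
    finally show ?thesis by simp
  qed
  also have "\<dots> \<le> \<alpha> * norm (v - G)"
    using \<alpha>(3) by (simp add: norm_triangle_ineq3)
  finally have 1: "norm (clip c v - \<alpha> *\<^sub>R v) \<le> \<alpha> * norm (v - G)" .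
  have 2: "norm (\<alpha> *\<^sub>R v - clip c G) = \<alpha> * norm (v - G)"
    using \<alpha>(3) by (simp add: clip_def \<alpha>_def[symmetric] flip: scaleR_diff_right)
  show ?thesis
    using norm_triangle_ineq[of "clip c v - \<alpha> *\<^sub>R v" "\<alpha> *\<^sub>R v - clip c G"] 1 2
    by (simp add: \<alpha>_def)
qed

text \<open>With \<open>d = c - norm G\<close>, clipping moves \<open>v\<close> by at most the
  positive part of \<open>norm (v - G) - d\<close>. Bounding this by a quadratic, from the square of
  \<open>norm (v - G) - 2 * d\<close>, lets the variance control its mean.\<close>

lemma norm_clip_error_le:
  assumes "c > 0" "norm G < c"
  shows "norm (clip c v - v) \<le> (norm (v - G))\<^sup>2 / (4 * (c - norm G))"
proof -
  define d where "d = c - norm G"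
  have d: "d > 0" using assms by (simp add: d_def)
  have "norm v \<le> norm G + norm (v - G)"
    using norm_triangle_ineq2[of v G] by simp
  then have "max 0 (norm v - c) \<le> max 0 (norm (v - G) - d)"
    by (simp add: d_def)
  also have "\<dots> \<le> (norm (v - G))\<^sup>2 / (4 * d)"
  proof -
    have "0 \<le> (norm (v - G) - 2 * d)\<^sup>2" by simp
    then have "(norm (v - G) - d) * (4 * d) \<le> (norm (v - G))\<^sup>2"
      by (simp add: power2_eq_square algebra_simps)
    then show ?thesis
      using d by (simp add: pos_le_divide_eq)
  qed
  finally show ?thesis
    using norm_clip_diff[OF assms(1), of v] by (simp add: norm_minus_commute d_def)
qed

text \<open>Expanding the square on the right produces the same multiple of
  \<open>G \<bullet> v\<close> as clipping \<open>G\<close> alone, so AM-GM on the norms settles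
  unclipped \<open>v\<close>. Clipping \<open>v\<close> adds a correction handled by
  Cauchy-Schwarz.\<close>

lemma half_norm_clip_minus_inner_le:
  assumes "c > 0" "c \<le> norm G"
  shows "(norm (clip c v))\<^sup>2 / 2 - clip c G \<bullet> clip c v \<le> clip_factor c G / 2 * (norm (v - G))\<^sup>2"
proof -
  define k R w where "k = norm v" and "R = norm G" and "w = G \<bullet> v"
  have R: "R > 0" "c \<le> R" using assms by (auto simp: R_def)
  have \<alpha>: "clip_factor c G = c / R" using assms by (simp add: clip_factor_large R_def)
  have a: "(norm (v - G))\<^sup>2 = k\<^sup>2 - 2 * w + R\<^sup>2"
    by (simp add: k_def R_def w_def power2_norm_eq_inner inner_diff_left inner_diff_right
        inner_commute)
  have w: "w \<le> k * R"
    using norm_cauchy_schwarz[of G v] by (simp add: k_def R_def w_def mult.commute)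
  have amgm: "c * k \<le> c / R / 2 * (k\<^sup>2 + R\<^sup>2)"
  proof -
    have "0 \<le> c * (k - R)\<^sup>2" using assms by simp
    then show ?thesis using R by (simp add: field_simps power2_eq_square)
  qed
  show ?thesis
  proof (cases "k \<le> c")
    case True
    then have v: "clip c v = v" by (simp add: clip_def clip_factor_small k_def)
    have "k\<^sup>2 \<le> c * k" using True by (simp add: k_def power2_eq_square mult_right_mono)
    moreover have "0 \<le> k\<^sup>2" by simp
    ultimately have "k\<^sup>2 / 2 \<le> c / R / 2 * (k\<^sup>2 + R\<^sup>2)" using amgm by linarith
    then have "k\<^sup>2 / 2 - c / R * w \<le> c / R / 2 * (k\<^sup>2 - 2 * w + R\<^sup>2)"
      by (simp add: algebra_simps)
    moreover have "clip c G \<bullet> v = c / R * w"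
      by (simp add: clip_def \<alpha> w_def)
    ultimately show ?thesis
      unfolding v a \<alpha> by (simp add: k_def)
  next
    case False
    then have k: "c < k" by simp
    have n: "norm (clip c v) = c" using k assms by (simp add: norm_clip k_def)
    have "clip c G \<bullet> clip c v = c / R * (c / k) * w"
      using k assms by (simp add: clip_def \<alpha> clip_factor_large w_def k_def mult_ac)
    \<comment> \<open>This is the change caused by replacing \<open>c / k\<close> by 1 in the inner
      product; its bound evaluates to \<open>c * k - c\<^sup>2\<close>.\<close>
    moreover have "c / R * (1 - c / k) * w \<le> c / R * (1 - c / k) * (k * R)"
      using k R assms by (intro mult_left_mono w) simp_all
    moreover have "c / R * (1 - c / k) * (k * R) = c * k - c\<^sup>2"
      using k R assms by (simp add: field_simps power2_eq_square)
    moreover have "c / R * (1 - c / k) * w = c / R * w - c / R * (c / k) * w"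
      by (simp add: right_diff_distrib left_diff_distrib)
    moreover have "0 \<le> c\<^sup>2" by simp
    ultimately have "c\<^sup>2 / 2 - clip c G \<bullet> clip c v \<le> c / R / 2 * (k\<^sup>2 + R\<^sup>2) - c / R * w"
      using amgm by linarith
    then show ?thesis
      unfolding n a \<alpha> by (simp add: algebra_simps)
  qed
qed

subsection \<open>Descent under generalized smoothness\<close>

text \<open>Every gradient on the segment is compared with the one at \<open>x\<close>, so the
  constant involves only \<open>gradient f x\<close>.\<close>

lemma descent_inequality:
  assumes smooth: "L0_L1_smooth L0 L1 f" and near: "L1 = 0 \<or> norm h \<le> 1 / L1"
  shows "f (x + h) \<le> f x + gradient f x \<bullet> h
    + (L0 + norm (gradient f x) * L1) / 2 * (norm h)\<^sup>2"
proof -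
  define G where "G = gradient f x"
  define K where "K = L0 + norm G * L1"
  \<comment> \<open>The claim is \<open>\<psi> 1 \<le> \<psi> 0\<close>; smoothness and
    Cauchy-Schwarz make the derivative nonpositive on [0, 1].\<close>
  define \<psi> where "\<psi> t = f (x + t *\<^sub>R h) - t * (G \<bullet> h) - K * t\<^sup>2 / 2 * (norm h)\<^sup>2" for t :: real
  have deriv: "(\<psi> has_real_derivative
      gradient f (x + t *\<^sub>R h) \<bullet> h - G \<bullet> h - K * t * (norm h)\<^sup>2) (at t)" for t
  proof -
    have "GDERIV f (x + t *\<^sub>R h) :> gradient f (x + t *\<^sub>R h)"
      using smooth by (intro GDERIV_gradient) (simp add: L0_L1_smooth_def)
    then have "(f has_derivative (\<lambda>k. k \<bullet> gradient f (x + t *\<^sub>R h))) (at (x + t *\<^sub>R h))"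
      by (simp add: gderiv_def)
    moreover have "((\<lambda>t. x + t *\<^sub>R h) has_derivative (\<lambda>s. s *\<^sub>R h)) (at t)"
      by (auto intro!: derivative_eq_intros)
    ultimately have "((\<lambda>t. f (x + t *\<^sub>R h)) has_derivative
        (\<lambda>s. (s *\<^sub>R h) \<bullet> gradient f (x + t *\<^sub>R h))) (at t)"
      by (rule has_derivative_compose[rotated])
    then have [derivative_intros]: "((\<lambda>t. f (x + t *\<^sub>R h)) has_real_derivative
        gradient f (x + t *\<^sub>R h) \<bullet> h) (at t)"
      by (simp add: has_field_derivative_def inner_commute mult.commute[of _ "_ \<bullet> _"]
          mult_commute_abs)
    show ?thesis
      unfolding \<psi>_def by (auto intro!: derivative_eq_intros)
  qed
  have nonpos: "gradient f (x + t *\<^sub>R h) \<bullet> h - G \<bullet> h - K * t * (norm h)\<^sup>2 \<le> 0"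
    if t: "0 \<le> t" "t \<le> 1" for t
  proof -
    have "norm (t *\<^sub>R h) \<le> norm h"
      using t by (simp add: mult_left_le_one_le)
    then have "L1 = 0 \<or> norm (x - (x + t *\<^sub>R h)) \<le> 1 / L1"
      using near by auto
    then have "norm (gradient f x - gradient f (x + t *\<^sub>R h))
        \<le> (L0 + norm (gradient f x) * L1) * norm (x - (x + t *\<^sub>R h))"
      using smooth unfolding L0_L1_smooth_def by blast
    then have "norm (gradient f (x + t *\<^sub>R h) - G) \<le> K * (t * norm h)"
      using t by (simp add: G_def K_def norm_minus_commute)
    then have "norm (gradient f (x + t *\<^sub>R h) - G) * norm h \<le> K * (t * norm h) * norm h"
      by (rule mult_right_mono) simp
    moreover have "(gradient f (x + t *\<^sub>R h) - G) \<bullet> h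
        \<le> norm (gradient f (x + t *\<^sub>R h) - G) * norm h"
      by (rule norm_cauchy_schwarz)
    ultimately show ?thesis
      by (simp add: inner_diff_left power2_eq_square algebra_simps)
  qed
  have "\<psi> 1 \<le> \<psi> 0"
  proof (rule DERIV_nonpos_imp_nonincreasing[where f = \<psi>])
    fix t :: real assume "0 \<le> t" "t \<le> 1"
    then show "\<exists>y. (\<psi> has_real_derivative y) (at t) \<and> y \<le> 0"
      using deriv[of t] nonpos[of t] by (intro exI conjI)
  qed simp
  then show ?thesis
    by (simp add: \<psi>_def G_def K_def)
qed

lemma L0_L1_smooth_continuous_on:
  assumes "L0_L1_smooth L0 L1 f"
  shows "continuous_on A f"
  using assms unfolding L0_L1_smooth_def
  by (meson continuous_at_imp_continuous_on differentiable_imp_continuous_within)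

text \<open>The weight \<open>1 / \<alpha>\<close> lost by replacing the gradient with its clipped version
  is exactly what turns the local smoothness constant into \<open>L\<^sub>0 + c L\<^sub>1\<close>.\<close>

lemma clipped_step_descent:
  fixes f :: "'a::euclidean_space \<Rightarrow> real"
  assumes smooth: "L0_L1_smooth L0 L1 f" and c: "c > 0" and eta: "\<eta> > 0"
    and step: "\<eta> * (L0 + c * L1) \<le> 1" and u: "norm u \<le> c"
  shows "clip_factor c (gradient f x) * (f (x - \<eta> *\<^sub>R u) - f x)
    \<le> \<eta> * (\<eta> * (L0 + c * L1) / 2 * (norm u)\<^sup>2 - clip c (gradient f x) \<bullet> u)"
proof -
  define G where "G = gradient f x"
  define \<alpha> where "\<alpha> = clip_factor c G"
  have L: "0 \<le> L0" "0 \<le> L1" using smooth by (auto simp: L0_L1_smooth_def)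
  have \<alpha>: "0 < \<alpha>" "\<alpha> \<le> 1" using c by (auto simp: \<alpha>_def clip_factor_pos clip_factor_le_1)
  \<comment> \<open>The step stays within the smoothness radius: \<open>\<eta> * c * L1\<close> is
    at most \<open>\<eta> * (L0 + c * L1)\<close> as \<open>L0\<close> is nonnegative.\<close>
  have near: "L1 = 0 \<or> norm (- (\<eta> *\<^sub>R u)) \<le> 1 / L1"
  proof (cases "L1 = 0")
    case False
    then have "L1 > 0" using L by simp
    have "\<eta> * norm u * L1 \<le> \<eta> * c * L1"
      using eta L u by (simp add: mult_left_mono mult_right_mono)
    also have "\<dots> \<le> 1"
      using step mult_nonneg_nonneg[OF less_imp_le[OF eta] L(1)] by (simp add: algebra_simps)
    finally show ?thesis
      using \<open>L1 > 0\<close> eta by (simp add: pos_le_divide_eq)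
  qed simp
  \<comment> \<open>This bound absorbs the \<open>L1\<close> part of the weighted smoothness
    constant, and \<open>\<alpha> \<le> 1\<close> the \<open>L0\<close> part.\<close>
  have "\<alpha> * norm G \<le> c"
    using norm_clip[OF c, of G] \<alpha> by (simp add: clip_def \<alpha>_def)
  then have "\<alpha> * (L0 + norm G * L1) \<le> L0 + c * L1"
    using mult_right_mono[of "\<alpha> * norm G" c L1] mult_right_mono[of \<alpha> 1 L0] L \<alpha>
    by (simp add: algebra_simps)
  then have K: "\<alpha> * (L0 + norm G * L1) / 2 * (\<eta> * norm u)\<^sup>2
      \<le> (L0 + c * L1) / 2 * (\<eta> * norm u)\<^sup>2"
    by (intro mult_right_mono divide_right_mono) simp_all
  have "f (x - \<eta> *\<^sub>R u) - f x \<le> - \<eta> * (G \<bullet> u) + (L0 + norm G * L1) / 2 * (\<eta> * norm u)\<^sup>2"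
    using descent_inequality[OF smooth near, of x] eta by (simp add: G_def)
  then have "\<alpha> * (f (x - \<eta> *\<^sub>R u) - f x)
      \<le> \<alpha> * (- \<eta> * (G \<bullet> u) + (L0 + norm G * L1) / 2 * (\<eta> * norm u)\<^sup>2)"
    using \<alpha> by (intro mult_left_mono) simp_all
  also have "\<dots> = - \<eta> * (\<alpha> * (G \<bullet> u)) + \<alpha> * (L0 + norm G * L1) / 2 * (\<eta> * norm u)\<^sup>2"
    by (simp add: algebra_simps)
  also have "\<dots> \<le> - \<eta> * (\<alpha> * (G \<bullet> u)) + (L0 + c * L1) / 2 * (\<eta> * norm u)\<^sup>2"
    using K by simp
  also have "\<dots> = \<eta> * (\<eta> * (L0 + c * L1) / 2 * (norm u)\<^sup>2 - clip c G \<bullet> u)"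
    by (simp add: clip_def \<alpha>_def power2_eq_square algebra_simps add_divide_distrib)
  finally show ?thesis
    by (simp add: \<alpha>_def G_def)
qed

subsection \<open>The clipped stochastic gradient\<close>

text \<open>This is \<kappa> of the theorem. It equals \<open>2 * \<sigma> ^ 4 / c\<^sup>2\<close>
  for \<open>\<sigma> \<le> c\<close>; beyond that only a linear lower bound is used.\<close>

definition bias_bound :: "real \<Rightarrow> real \<Rightarrow> real" where
  "bias_bound c \<sigma> = (let \<epsilon> = 4 * min \<sigma> (\<sigma>\<^sup>2 / c) in \<epsilon> * min (\<epsilon> / 8) (2 * c))"

lemma bias_bound_le:
  assumes "0 < c" "0 \<le> \<sigma>"
  shows "bias_bound c \<sigma> \<le> 1 / 8 * (4 * min \<sigma> (\<sigma>\<^sup>2 / c))\<^sup>2"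
proof -
  define \<epsilon> where "\<epsilon> = 4 * min \<sigma> (\<sigma>\<^sup>2 / c)"
  have "\<epsilon> \<ge> 0" using assms by (simp add: \<epsilon>_def)
  then have "\<epsilon> * min (\<epsilon> / 8) (2 * c) \<le> \<epsilon> * (\<epsilon> / 8)"
    by (intro mult_left_mono) simp_all
  then show ?thesis
    by (simp add: bias_bound_def \<epsilon>_def power2_eq_square)
qed

lemma bias_bound_small:
  assumes "0 < c" "0 \<le> \<sigma>" "\<sigma> \<le> c"
  shows "bias_bound c \<sigma> = 2 * c\<^sup>2 * (\<sigma> / c) ^ 4"
proof -
  have "\<sigma>\<^sup>2 \<le> \<sigma> * c"
    using assms by (simp add: power2_eq_square mult_left_mono)
  moreover have "\<sigma>\<^sup>2 \<le> c\<^sup>2"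
    using assms by (intro power_mono)
  ultimately have "min \<sigma> (\<sigma>\<^sup>2 / c) = \<sigma>\<^sup>2 / c" "\<sigma>\<^sup>2 / c \<le> c"
    using assms by (auto simp: min_def field_simps power2_eq_square)
  then show ?thesis
    using assms by (simp add: bias_bound_def Let_def min_def)
      (simp add: field_simps power2_eq_square power4_eq_xxxx)
qed

lemma bias_bound_large:
  assumes "0 < c" "c \<le> \<sigma>"
  shows "2 * c * \<sigma> \<le> bias_bound c \<sigma>"
proof -
  have "\<sigma> * c \<le> \<sigma>\<^sup>2"
    using assms by (simp add: power2_eq_square mult_left_mono)
  then have "min \<sigma> (\<sigma>\<^sup>2 / c) = \<sigma>"
    using assms by (simp add: min_def field_simps)
  moreover have "4 * \<sigma> * (c / 2) \<le> 4 * \<sigma> * min (4 * \<sigma> / 8) (2 * c)"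
    using assms by (intro mult_left_mono) auto
  ultimately show ?thesis
    by (simp add: bias_bound_def Let_def mult_ac)
qed

lemma bias_bound_nonneg:
  assumes "0 < c" "0 \<le> \<sigma>"
  shows "0 \<le> bias_bound c \<sigma>"
  using assms by (simp add: bias_bound_def Let_def)

text \<open>A sum of two squares whose quadratic terms cancel. It serves gradients with norm at
  least \<open>c\<close>.\<close>

lemma quartic_bound_far:
  fixes u :: real
  shows "u - 1 / 2 \<le> u ^ 4"
proof -
  have "0 \<le> (u\<^sup>2 - 1 / 2)\<^sup>2 + (u - 1 / 2)\<^sup>2" by simp
  also have "\<dots> = u ^ 4 - u + 1 / 2"
    by (simp add: power2_eq_square power4_eq_xxxx algebra_simps)
  finally show ?thesis by simp
qed

text \<open>The left side is \<open>r * u - r\<^sup>2 / 2\<close> at \<open>r = 3 / 4\<close>, the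
  last breakpoint in \<open>bias_absorption\<close>. The sum of squares leaves a slack of
  1/64.\<close>

lemma quartic_bound_near:
  fixes u :: real
  shows "3 / 4 * u - 9 / 32 \<le> 2 * u ^ 4"
proof -
  have "0 \<le> 2 * (u\<^sup>2 - 1 / 4)\<^sup>2 + (u - 3 / 8)\<^sup>2" by simp
  also have "\<dots> = 2 * u ^ 4 - 3 / 4 * u + 17 / 64"
    by (simp add: power2_eq_square power4_eq_xxxx algebra_simps)
  finally show ?thesis by simp
qed

text \<open>In units of \<open>c\<close>: \<open>r\<close> is the gradient norm, \<open>u\<close> the noise level and \<open>b\<close> the bias. The
  variance bound \<open>b \<le> u\<^sup>2 / (4 (1 - r))\<close> is used away from the clipping threshold; close to it
  the term \<open>- r\<^sup>2 / 2\<close> compensates a bias of order \<open>u\<close>.\<close>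

lemma bias_absorption:
  fixes r u b :: real
  assumes r: "0 \<le> r" "r \<le> 1" and u: "0 \<le> u" "u \<le> 1" and b: "0 \<le> b" "b \<le> u"
    and bias: "r < 1 \<Longrightarrow> b \<le> u\<^sup>2 / (4 * (1 - r))"
  shows "r * b - r\<^sup>2 / 2 \<le> 2 * u ^ 4"
proof -
  have young: "r * b - r\<^sup>2 / 2 \<le> b\<^sup>2 / 2"
    using zero_le_power2[of "r - b"] by (simp add: power2_eq_square algebra_simps)
  \<comment> \<open>In turn: \<open>b \<le> u\<close> suffices for large \<open>u\<close>; then the
    variance bound gives \<open>b \<le> u\<^sup>2 / 2\<close>; then it gives
    \<open>b \<le> r / 2\<close>, making the left side nonpositive; near the threshold
    \<open>b \<le> u\<close> is used again.\<close>
  consider "1 / 2 \<le> u" | "u \<le> 1 / 2" "r \<le> 1 / 2" | "u \<le> 1 / 2" "1 / 2 \<le> r" "r \<le> 3 / 4"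
    | "u \<le> 1 / 2" "3 / 4 \<le> r"
    by linarith
  then show ?thesis
  proof cases
    case 1
    then have "(1 / 2)\<^sup>2 \<le> u\<^sup>2" by (intro power_mono) simp_all
    then have "1 / 4 * u\<^sup>2 \<le> u\<^sup>2 * u\<^sup>2" by (intro mult_right_mono) (simp_all add: power2_eq_square)
    moreover have "b\<^sup>2 \<le> u\<^sup>2" using b by (intro power_mono) simp_all
    ultimately show ?thesis using young by (simp add: power4_eq_xxxx power2_eq_square)
  next
    case 2
    have "u\<^sup>2 / (4 * (1 - r)) \<le> u\<^sup>2 / 2" using 2 by (intro divide_left_mono) auto
    then have "b \<le> u\<^sup>2 / 2" using bias 2 by linarith
    then have "b\<^sup>2 \<le> (u\<^sup>2 / 2)\<^sup>2" using b by (intro power_mono) auto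
    moreover have "(u\<^sup>2 / 2)\<^sup>2 = u ^ 4 / 4" by (simp add: power_divide flip: power_mult)
    moreover have "0 \<le> u ^ 4" by simp
    ultimately show ?thesis using young by linarith
  next
    case 3
    have "u\<^sup>2 \<le> (1 / 2)\<^sup>2" using u 3 by (intro power_mono) simp_all
    \<comment> \<open>Subtracting this nonnegative product cancels the square of \<open>r\<close>
      and leaves \<open>3 / 4 - r / 2\<close>, at least 3/8 here.\<close>
    also have "\<dots> \<le> 2 * r * (1 - r) - 2 * ((r - 1 / 2) * (3 / 4 - r))"
      using 3 by (simp add: power2_eq_square field_simps)
    also have "\<dots> \<le> 2 * r * (1 - r)"
      using 3 by simp
    finally have "u\<^sup>2 \<le> 2 * r * (1 - r)" .
    then have "u\<^sup>2 / (4 * (1 - r)) \<le> r / 2"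
      using 3 by (simp add: pos_divide_le_eq algebra_simps)
    then have "b \<le> r / 2"
      using bias 3 by linarith
    then have "r * b \<le> r * (r / 2)"
      using r by (intro mult_left_mono)
    also have "\<dots> = r\<^sup>2 / 2" by (simp add: power2_eq_square)
    finally have "r * b - r\<^sup>2 / 2 \<le> 0" by simp
    also have "\<dots> \<le> 2 * u ^ 4" by simp
    finally show ?thesis .
  next
    case 4
    have "r * b \<le> r * u" using r b by (intro mult_left_mono) simp_all
    \<comment> \<open>Half of this product is the drop of \<open>r * u - r\<^sup>2 / 2\<close>
      between 3/4 and \<open>r\<close>.\<close>
    moreover have "0 \<le> (r - 3 / 4) * (r + 3 / 4 - 2 * u)" using 4 by simp
    ultimately have "r * b - r\<^sup>2 / 2 \<le> 3 / 4 * u - 9 / 32"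
      by (simp add: power2_eq_square algebra_simps)
    then show ?thesis using quartic_bound_near[of u] by linarith
  qed
qed

section \<open>Bias and second moment of one clipped estimate at a fixed point\<close>

locale clipped_estimate = prob_space D
  for D :: "'s measure" +
  fixes g :: "'s \<Rightarrow> 'a::euclidean_space" and G :: 'a and c \<sigma> :: real
  assumes c: "0 < c" and sigma: "0 \<le> \<sigma>"
    and integrable_g: "integrable D g" and mean_g: "expectation g = G"
    and integrable_sq: "integrable D (\<lambda>s. (norm (g s - G))\<^sup>2)"
    and variance_g: "expectation (\<lambda>s. (norm (g s - G))\<^sup>2) \<le> \<sigma>\<^sup>2"
begin

lemma measurable_g [measurable]: "g \<in> borel_measurable D"
  using integrable_g by simp

lemma measurable_clip_g [measurable]: "(\<lambda>s. clip c (g s)) \<in> borel_measurable D"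
  using measurable_compose[OF measurable_g borel_measurable_clip[OF c]] .

lemma norm_clip_g: "norm (clip c (g s)) \<le> c"
  using c by (simp add: norm_clip)

lemma integrable_clip: "integrable D (\<lambda>s. clip c (g s))"
  by (rule integrable_const_bound[of _ c]) (simp_all add: norm_clip_g)

lemma integrable_norm_sq_clip: "integrable D (\<lambda>s. (norm (clip c (g s)))\<^sup>2)"
  by (rule integrable_const_bound[of _ "c\<^sup>2"]) (simp_all add: norm_clip_g power_mono)

lemma integrable_dev: "integrable D (\<lambda>s. norm (g s - G))"
  using integrable_g by simp

lemma mean_dev: "expectation (\<lambda>s. norm (g s - G)) \<le> \<sigma>"
proof -
  \<comment> \<open>Nonnegativity of the variance of \<open>norm (g s - G)\<close>.\<close>
  have "(expectation (\<lambda>s. norm (g s - G)))\<^sup>2 \<le> expectation (\<lambda>s. (norm (g s - G))\<^sup>2)"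
    using variance_eq[OF integrable_dev integrable_sq]
      variance_positive[of "\<lambda>s. norm (g s - G)"] by simp
  then show ?thesis
    using variance_g sigma by (meson order_trans power2_le_imp_le)
qed

text \<open>It dominates the distance of the clipped mean from \<open>clip c G\<close> and inherits
  both the absolute and the relative pointwise bound.\<close>

definition clip_dev :: real where
  "clip_dev = expectation (\<lambda>s. norm (clip c (g s) - clip c G))"

lemma integrable_clip_dev: "integrable D (\<lambda>s. norm (clip c (g s) - clip c G))"
  using integrable_clip by simp

lemma clip_dev_le: "clip_dev \<le> \<sigma>"
proof -
  have "clip_dev \<le> expectation (\<lambda>s. norm (g s - G))"
    unfolding clip_dev_def
    by (intro integral_mono integrable_clip_dev integrable_dev clip_nonexpansive c)
  then show ?thesis using mean_dev by simp
qed

lemma clip_dev_le_relative: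
  assumes "c \<le> norm G"
  shows "clip_dev \<le> 2 * clip_factor c G * \<sigma>"
proof -
  have "clip_dev \<le> expectation (\<lambda>s. 2 * clip_factor c G * norm (g s - G))"
    unfolding clip_dev_def using assms c
    by (intro integral_mono integrable_clip_dev integrable_mult_right integrable_dev
        clip_diff_le_relative)
  also have "\<dots> \<le> 2 * clip_factor c G * \<sigma>"
    using mean_dev clip_factor_pos[OF c, of G] by (simp add: integrable_dev)
  finally show ?thesis .
qed

lemma norm_mean_clip_diff: "norm (expectation (\<lambda>s. clip c (g s)) - clip c G) \<le> clip_dev"
proof -
  have "expectation (\<lambda>s. clip c (g s)) - clip c G = expectation (\<lambda>s. clip c (g s) - clip c G)"
    using integrable_clip by (simp add: prob_space)
  then show ?thesis
    by (simp add: clip_dev_def)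
qed

text \<open>The unclipped estimate has mean \<open>G\<close>, so the bias is the mean of the
  clipping error, which is quadratic in the noise.\<close>

lemma norm_bias:
  assumes "norm G < c"
  shows "norm (expectation (\<lambda>s. clip c (g s)) - G) \<le> \<sigma>\<^sup>2 / (4 * (c - norm G))"
proof -
  have "norm (expectation (\<lambda>s. clip c (g s)) - G) = norm (expectation (\<lambda>s. clip c (g s) - g s))"
    using integrable_clip integrable_g by (simp add: mean_g)
  also have "\<dots> \<le> expectation (\<lambda>s. norm (clip c (g s) - g s))"
    by simp
  also have "\<dots> \<le> expectation (\<lambda>s. (norm (g s - G))\<^sup>2 / (4 * (c - norm G)))"
    using integrable_clip integrable_g integrable_sq assms c
    by (intro integral_mono norm_clip_error_le) simp_all
  also have "\<dots> \<le> \<sigma>\<^sup>2 / (4 * (c - norm G))"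
    using variance_g assms by (simp add: divide_right_mono)
  finally show ?thesis .
qed

lemma inner_mean_clip_le:
  "(norm (clip c G))\<^sup>2 - clip c G \<bullet> expectation (\<lambda>s. clip c (g s))
    \<le> norm (clip c G) * norm (expectation (\<lambda>s. clip c (g s)) - clip c G)"
  using norm_cauchy_schwarz[of "clip c G" "clip c G - expectation (\<lambda>s. clip c (g s))"]
  by (simp add: inner_diff_right power2_norm_eq_inner norm_minus_commute)

text \<open>Below the threshold, dividing by \<open>c\<close> reduces
  \<open>\<sigma> \<le> c\<close> to \<open>bias_absorption\<close>. At or above it the clipped
  gradient has norm \<open>c\<close>, and the extra factor \<alpha> comes from the relative bound
  or, for \<alpha> > 1/2, from 1 < 2\<alpha>. For \<open>\<sigma> > c\<close> the linear lower bound
  on \<kappa> suffices.\<close>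

lemma clipped_bias_bound:
  "(norm (clip c G))\<^sup>2 / 2 - clip c G \<bullet> expectation (\<lambda>s. clip c (g s))
    \<le> clip_factor c G * bias_bound c \<sigma>"
proof (cases "norm G < c")
  case True
  define r b where "r = norm G" and "b = norm (expectation (\<lambda>s. clip c (g s)) - G)"
  have \<alpha>: "clip_factor c G = 1" and p: "clip c G = G"
    using True by (simp_all add: clip_def clip_factor_small)
  have r: "0 \<le> r" "r < c" using True by (auto simp: r_def)
  have b: "0 \<le> b" "b \<le> \<sigma>"
    using norm_mean_clip_diff clip_dev_le by (auto simp: b_def p)
  have bias: "b \<le> \<sigma>\<^sup>2 / (4 * (c - r))"
    using norm_bias True by (simp add: b_def r_def)
  have "r * b - r\<^sup>2 / 2 \<le> bias_bound c \<sigma>"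
  proof (cases "\<sigma> \<le> c")
    case small: True
    have "b / c \<le> \<sigma>\<^sup>2 / (4 * (c - r)) / c" using bias c by (intro divide_right_mono) simp_all
    also have "\<dots> = (\<sigma> / c)\<^sup>2 / (4 * (1 - r / c))"
      using c r by (simp add: field_simps power2_eq_square)
    finally have "r / c * (b / c) - (r / c)\<^sup>2 / 2 \<le> 2 * (\<sigma> / c) ^ 4"
      using r b c small sigma by (intro bias_absorption) (simp_all add: divide_right_mono)
    then have "c\<^sup>2 * (r / c * (b / c) - (r / c)\<^sup>2 / 2) \<le> c\<^sup>2 * (2 * (\<sigma> / c) ^ 4)"
      by (intro mult_left_mono) simp_all
    moreover have "c\<^sup>2 * (r / c * (b / c) - (r / c)\<^sup>2 / 2) = r * b - r\<^sup>2 / 2"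
      using c by (simp add: field_simps power2_eq_square)
    ultimately show ?thesis
      using bias_bound_small[OF c sigma small] by simp
  next
    case False
    have "r * b \<le> c * \<sigma>" using r b by (intro mult_mono) simp_all
    moreover have "0 \<le> c * \<sigma>" "0 \<le> r\<^sup>2" using c sigma by simp_all
    ultimately show ?thesis
      using bias_bound_large[OF c, of \<sigma>] False by linarith
  qed
  then show ?thesis
    using inner_mean_clip_le by (simp add: \<alpha> p r_def b_def)
next
  case False
  define \<alpha> where "\<alpha> = clip_factor c G"
  define e where "e = clip_dev"
  have \<alpha>: "0 < \<alpha>" "\<alpha> \<le> 1" using c by (auto simp: \<alpha>_def clip_factor_pos clip_factor_le_1)
  have p: "norm (clip c G) = c" using False c by (simp add: norm_clip)
  have e: "e \<le> \<sigma>" "e \<le> 2 * \<alpha> * \<sigma>"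
    using clip_dev_le clip_dev_le_relative False by (auto simp: e_def \<alpha>_def)
  have "c * norm (expectation (\<lambda>s. clip c (g s)) - clip c G) \<le> c * e"
    using norm_mean_clip_diff c by (simp add: e_def)
  then have *: "(norm (clip c G))\<^sup>2 / 2 - clip c G \<bullet> expectation (\<lambda>s. clip c (g s))
      \<le> c * e - c\<^sup>2 / 2"
    using inner_mean_clip_le by (simp add: p)
  have "c * e - c\<^sup>2 / 2 \<le> \<alpha> * bias_bound c \<sigma>"
  proof (cases "\<sigma> \<le> c")
    case small: True
    define u where "u = \<sigma> / c"
    have u: "e / c \<le> u" "e / c \<le> 2 * \<alpha> * u"
      using e c by (simp_all add: u_def divide_right_mono field_simps)
    have "e / c - 1 / 2 \<le> \<alpha> * (2 * u ^ 4)"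
    proof (cases "\<alpha> \<le> 1 / 2")
      case True
      \<comment> \<open>The relative bound supplies \<open>2 * \<alpha> * u\<close>, and
        \<open>\<alpha> \<le> 1 / 2\<close> lets \<alpha> be pulled out of the constant too.\<close>
      have "e / c - 1 / 2 \<le> 2 * \<alpha> * (u - 1 / 2)"
        using u True by (simp add: algebra_simps)
      also have "\<dots> \<le> 2 * \<alpha> * u ^ 4"
        using quartic_bound_far[of u] \<alpha> by (intro mult_left_mono) simp_all
      finally show ?thesis by simp
    next
      case False
      have "e / c - 1 / 2 \<le> u ^ 4"
        using u quartic_bound_far[of u] by linarith
      also have "\<dots> \<le> 2 * \<alpha> * u ^ 4"
        using False mult_right_mono[of 1 "2 * \<alpha>" "u ^ 4"] by simp
      finally show ?thesis by simp
    qed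
    then have "c\<^sup>2 * (e / c - 1 / 2) \<le> c\<^sup>2 * (\<alpha> * (2 * u ^ 4))"
      by (intro mult_left_mono) simp_all
    moreover have "c\<^sup>2 * (e / c - 1 / 2) = c * e - c\<^sup>2 / 2"
      using c by (simp add: field_simps power2_eq_square)
    ultimately show ?thesis
      using bias_bound_small[OF c sigma small] by (simp add: u_def mult_ac)
  next
    case large: False
    have "c * e \<le> c * (2 * \<alpha> * \<sigma>)" using e c by simp
    also have "\<dots> \<le> \<alpha> * bias_bound c \<sigma>"
      using bias_bound_large[OF c, of \<sigma>] large \<alpha> by (simp add: mult_ac)
    finally show ?thesis by (smt (verit) zero_le_power2 divide_nonneg_pos)
  qed
  then show ?thesis
    using * by (simp add: \<alpha>_def)
qed

lemma expectation_half_norm_minus_inner: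
  "expectation (\<lambda>s. (norm (clip c (g s)))\<^sup>2 / 2 - clip c G \<bullet> clip c (g s))
    = expectation (\<lambda>s. (norm (clip c (g s)))\<^sup>2) / 2 - clip c G \<bullet> expectation (\<lambda>s. clip c (g s))"
  using integrable_clip integrable_norm_sq_clip by simp

text \<open>For \<open>\<sigma> \<le> c\<close> a pointwise bound by the noise suffices, without any
  contribution from \<kappa>. For \<open>\<sigma> > c\<close> the second moment is at most
  \<open>c\<^sup>2\<close>, and \<open>2 * c * \<sigma> \<le> \<kappa>\<close> pays for the inner
  product.\<close>

lemma clipped_second_moment_bound:
  "expectation (\<lambda>s. (norm (clip c (g s)))\<^sup>2) / 2 - clip c G \<bullet> expectation (\<lambda>s. clip c (g s))
    \<le> clip_factor c G * (min (\<sigma>\<^sup>2) (c\<^sup>2) / 2 + bias_bound c \<sigma>)"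
proof -
  define \<alpha> where "\<alpha> = clip_factor c G"
  define V where "V = expectation (\<lambda>s. (norm (clip c (g s)))\<^sup>2)"
  define I where "I = clip c G \<bullet> expectation (\<lambda>s. clip c (g s))"
  have \<alpha>: "0 < \<alpha>" "\<alpha> \<le> 1" using c by (auto simp: \<alpha>_def clip_factor_pos clip_factor_le_1)
  have small: "V / 2 - I \<le> \<alpha> / 2 * \<sigma>\<^sup>2"
  proof -
    have "(norm (clip c (g s)))\<^sup>2 / 2 - clip c G \<bullet> clip c (g s) \<le> \<alpha> / 2 * (norm (g s - G))\<^sup>2" for s
    proof (cases "c \<le> norm G")
      case True
      then show ?thesis using half_norm_clip_minus_inner_le c by (simp add: \<alpha>_def)
    next
      case False
      then have "\<alpha> = 1" by (simp add: \<alpha>_def clip_factor_small)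
      moreover have "(norm (clip c (g s) - clip c G))\<^sup>2 \<le> (norm (g s - G))\<^sup>2"
        using clip_nonexpansive[OF c] by (intro power_mono) simp_all
      moreover have "(norm (clip c (g s) - clip c G))\<^sup>2
          = (norm (clip c (g s)))\<^sup>2 - 2 * (clip c G \<bullet> clip c (g s)) + (norm (clip c G))\<^sup>2"
        by (simp add: power2_norm_eq_inner inner_diff_left inner_diff_right inner_commute)
      moreover have "0 \<le> (norm (clip c G))\<^sup>2" by simp
      ultimately have "(norm (clip c (g s)))\<^sup>2 / 2 - clip c G \<bullet> clip c (g s)
          \<le> 1 / 2 * (norm (g s - G))\<^sup>2"
        by linarith
      then show ?thesis using \<open>\<alpha> = 1\<close> by simp
    qed
    then have "V / 2 - I \<le> expectation (\<lambda>s. \<alpha> / 2 * (norm (g s - G))\<^sup>2)"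
      unfolding V_def I_def expectation_half_norm_minus_inner[symmetric]
      using integrable_clip integrable_norm_sq_clip integrable_sq
      by (intro integral_mono) simp_all
    also have "\<dots> \<le> \<alpha> / 2 * \<sigma>\<^sup>2"
      using variance_g \<alpha> by simp
    finally show ?thesis .
  qed
  have \<kappa>: "0 \<le> bias_bound c \<sigma>" using c sigma by (rule bias_bound_nonneg)
  have "V / 2 - I \<le> \<alpha> * (min (\<sigma>\<^sup>2) (c\<^sup>2) / 2 + bias_bound c \<sigma>)"
  proof (cases "\<sigma> \<le> c")
    case True
    then have "\<sigma>\<^sup>2 \<le> c\<^sup>2" using sigma by (intro power_mono)
    then have "\<alpha> / 2 * \<sigma>\<^sup>2 = \<alpha> * (min (\<sigma>\<^sup>2) (c\<^sup>2) / 2)" by simp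
    also have "\<dots> \<le> \<alpha> * (min (\<sigma>\<^sup>2) (c\<^sup>2) / 2 + bias_bound c \<sigma>)"
      using \<alpha> \<kappa> by (intro mult_left_mono) simp_all
    finally show ?thesis using small by simp
  next
    case False
    then have "c\<^sup>2 \<le> \<sigma>\<^sup>2" using c by (intro power_mono) simp_all
    then have min: "min (\<sigma>\<^sup>2) (c\<^sup>2) = c\<^sup>2" by simp
    have V: "V \<le> c\<^sup>2"
    proof -
      have "V \<le> expectation (\<lambda>s. c\<^sup>2)"
        unfolding V_def using integrable_norm_sq_clip norm_clip_g
        by (intro integral_mono power_mono) simp_all
      then show ?thesis by (simp add: prob_space)
    qed
    have large: "2 * c * \<sigma> \<le> bias_bound c \<sigma>"
      using False c by (intro bias_bound_large) simp_all
    have "1 * (c * c) \<le> 2 * (c * \<sigma>)"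
      using False c by (intro mult_mono) simp_all
    then have \<kappa>_ge: "c\<^sup>2 \<le> bias_bound c \<sigma>"
      using large by (simp add: power2_eq_square)
    show ?thesis
    proof (cases "c \<le> norm G")
      case True
      have "norm (clip c G) = c" using True c by (simp add: norm_clip)
      then have "V / 2 - I \<le> c * norm (expectation (\<lambda>s. clip c (g s)) - clip c G)"
        using inner_mean_clip_le[unfolded \<open>norm (clip c G) = c\<close>] V zero_le_power2[of c]
        unfolding I_def by linarith
      also have "\<dots> \<le> c * (2 * \<alpha> * \<sigma>)"
        using norm_mean_clip_diff clip_dev_le_relative[OF True] c
        by (intro mult_left_mono) (simp_all add: \<alpha>_def)
      also have "\<dots> = \<alpha> * (2 * c * \<sigma>)" by simp
      also have "\<dots> \<le> \<alpha> * (min (\<sigma>\<^sup>2) (c\<^sup>2) / 2 + bias_bound c \<sigma>)"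
        using large \<alpha> min by (intro mult_left_mono) (simp_all add: add_increasing)
      finally show ?thesis .
    next
      case small_G: False
      then have "\<alpha> = 1" by (simp add: \<alpha>_def clip_factor_small)
      have G: "norm (clip c G) \<le> c" using c by (simp add: norm_clip)
      have "norm (expectation (\<lambda>s. clip c (g s))) \<le> expectation (\<lambda>s. norm (clip c (g s)))"
        by simp
      also have "\<dots> \<le> expectation (\<lambda>s. c)"
        using integrable_clip norm_clip_g by (intro integral_mono) simp_all
      finally have "norm (expectation (\<lambda>s. clip c (g s))) \<le> c" by (simp add: prob_space)
      then have "norm (clip c G) * norm (expectation (\<lambda>s. clip c (g s))) \<le> c * c"
        using G c by (intro mult_mono) simp_all
      then have "- I \<le> c\<^sup>2"
        using Cauchy_Schwarz_ineq2[of "clip c G" "expectation (\<lambda>s. clip c (g s))"]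
        by (simp add: I_def power2_eq_square)
      then show ?thesis
        using V \<kappa>_ge unfolding \<open>\<alpha> = 1\<close> min by simp
    qed
  qed
  then show ?thesis
    by (simp add: V_def I_def \<alpha>_def)
qed

text \<open>The expected decrease is affine in \<open>\<theta> = \<eta> \<beta> \<in> [0, 1]\<close>; the endpoint \<open>\<theta> = 0\<close> is the bias
  bound and the endpoint \<open>\<theta> = 1\<close> the second moment bound.\<close>

lemma expected_clipped_descent:
  fixes f :: "'a \<Rightarrow> real"
  assumes smooth: "L0_L1_smooth L0 L1 f" and eta: "\<eta> > 0"
    and step: "\<eta> * (L0 + c * L1) \<le> 1" and G: "G = gradient f x"
    and int: "integrable D (\<lambda>s. f (x - \<eta> *\<^sub>R clip c (g s)))"
  shows "expectation (\<lambda>s. f (x - \<eta> *\<^sub>R clip c (g s))) - f x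
    \<le> - (\<eta> / 2) * (1 - \<eta> * (L0 + c * L1)) * clip_factor c G * (norm G)\<^sup>2
      + \<eta>\<^sup>2 * (L0 + c * L1) / 2 * min (\<sigma>\<^sup>2) (c\<^sup>2) + \<eta> * bias_bound c \<sigma>"
proof -
  define \<alpha> where "\<alpha> = clip_factor c G"
  define \<theta> where "\<theta> = \<eta> * (L0 + c * L1)"
  define P where "P = (norm (clip c G))\<^sup>2"
  define V where "V = expectation (\<lambda>s. (norm (clip c (g s)))\<^sup>2)"
  define I where "I = clip c G \<bullet> expectation (\<lambda>s. clip c (g s))"
  define m where "m = min (\<sigma>\<^sup>2) (c\<^sup>2)"
  define \<kappa> where "\<kappa> = bias_bound c \<sigma>"
  have \<alpha>: "0 < \<alpha>" using c by (auto simp: \<alpha>_def clip_factor_pos)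
  have \<theta>: "0 \<le> \<theta>" "\<theta> \<le> 1"
    using smooth eta c step by (auto simp: \<theta>_def L0_L1_smooth_def)
  \<comment> \<open>One factor \<alpha> cancels against the weight on the left; the other remains in
    the claim.\<close>
  have P: "P = \<alpha> * (\<alpha> * (norm G)\<^sup>2)"
    using \<alpha> by (simp add: P_def clip_def \<alpha>_def power_mult_distrib power2_eq_square)
  have "\<alpha> * (expectation (\<lambda>s. f (x - \<eta> *\<^sub>R clip c (g s))) - f x)
      = expectation (\<lambda>s. \<alpha> * (f (x - \<eta> *\<^sub>R clip c (g s)) - f x))"
    using int by (simp add: prob_space)
  also have "\<dots> \<le> expectation (\<lambda>s. \<eta> * (\<theta> / 2 * (norm (clip c (g s)))\<^sup>2 - clip c G \<bullet> clip c (g s)))"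
    using clipped_step_descent[OF smooth c eta step norm_clip_g, of x]
      int integrable_clip integrable_norm_sq_clip
    by (intro integral_mono) (simp_all add: \<alpha>_def \<theta>_def G)
  also have "\<dots> = \<eta> * (\<theta> / 2 * V - I)"
    using integrable_clip integrable_norm_sq_clip by (simp add: V_def I_def)
  also have "\<dots> \<le> \<eta> * (\<alpha> * (- (1 - \<theta>) / 2 * (\<alpha> * (norm G)\<^sup>2) + \<theta> / 2 * m + \<kappa>))"
  proof -
    have "(1 - \<theta>) * (P / 2 - I) \<le> (1 - \<theta>) * (\<alpha> * \<kappa>)"
      using \<theta> clipped_bias_bound
      by (intro mult_left_mono) (simp_all add: P_def I_def \<alpha>_def \<kappa>_def)
    moreover have "\<theta> * (V / 2 - I) \<le> \<theta> * (\<alpha> * (m / 2 + \<kappa>))"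
      using \<theta> clipped_second_moment_bound
      by (intro mult_left_mono) (simp_all add: V_def I_def \<alpha>_def \<kappa>_def m_def)
    ultimately have "\<theta> / 2 * V - I \<le> - (1 - \<theta>) / 2 * P + \<alpha> * (\<theta> / 2 * m + \<kappa>)"
      by (simp add: field_simps)
    also have "\<dots> = \<alpha> * (- (1 - \<theta>) / 2 * (\<alpha> * (norm G)\<^sup>2) + \<theta> / 2 * m + \<kappa>)"
      unfolding P by (simp add: algebra_simps)
    finally show ?thesis using eta by simp
  qed
  also have "\<dots> = \<alpha> * (\<eta> * (- (1 - \<theta>) / 2 * (\<alpha> * (norm G)\<^sup>2) + \<theta> / 2 * m + \<kappa>))"
    by simp
  finally have "expectation (\<lambda>s. f (x - \<eta> *\<^sub>R clip c (g s))) - f x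
      \<le> \<eta> * (- (1 - \<theta>) / 2 * (\<alpha> * (norm G)\<^sup>2) + \<theta> / 2 * m + \<kappa>)"
    using \<alpha> by simp
  also have "\<dots> = - (\<eta> / 2) * (1 - \<theta>) * \<alpha> * (norm G)\<^sup>2 + \<eta> * \<theta> / 2 * m + \<eta> * \<kappa>"
    by (simp add: field_simps)
  finally show ?thesis
    by (simp add: \<theta>_def m_def \<kappa>_def \<alpha>_def power2_eq_square mult.assoc)
qed

end

subsection \<open>Conditioning on the current iterate\<close>

lemma clip_sgd_measurable:
  assumes "clip_sgd M D f c \<eta> \<sigma> g \<xi> x" "c > 0"
  shows "x t \<in> borel_measurable M"
proof (induction t)
  case 0
  then show ?case using assms by (simp add: clip_sgd_def)
next
  case (Suc t)
  have \<xi>: "\<xi> t \<in> measurable M D"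
    and g: "(\<lambda>(y, s). g y s) \<in> borel_measurable (borel \<Otimes>\<^sub>M D)"
    using assms(1) by (auto simp: clip_sgd_def stochastic_gradient_def)
  have "(\<lambda>\<omega>. (x t \<omega>, \<xi> t \<omega>)) \<in> measurable M (borel \<Otimes>\<^sub>M D)"
    using Suc \<xi> by (rule measurable_Pair)
  from measurable_compose[OF this g]
  have "(\<lambda>\<omega>. clip c (g (x t \<omega>) (\<xi> t \<omega>))) \<in> borel_measurable M"
    using measurable_compose[OF _ borel_measurable_clip[OF assms(2)]] by simp
  with Suc have "(\<lambda>\<omega>. x t \<omega> - \<eta> *\<^sub>R clip c (g (x t \<omega>) (\<xi> t \<omega>))) \<in> borel_measurable M"
    by simp
  moreover have "x (Suc t) \<omega> = x t \<omega> - \<eta> *\<^sub>R clip c (g (x t \<omega>) (\<xi> t \<omega>))" if "\<omega> \<in> space M" for \<omega>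
    using assms(1) that by (simp add: clip_sgd_def)
  ultimately show ?case
    by (simp cong: measurable_cong)
qed

lemma clip_sgd_joint_distr:
  assumes "clip_sgd M D f c \<eta> \<sigma> g \<xi> x" "c > 0"
  shows "distr M borel (x t) \<Otimes>\<^sub>M distr M D (\<xi> t)
    = distr M (borel \<Otimes>\<^sub>M D) (\<lambda>\<omega>. (x t \<omega>, \<xi> t \<omega>))"
proof -
  interpret prob_space M using assms(1) by (simp add: clip_sgd_def)
  have [measurable]: "x t \<in> borel_measurable M" by (rule clip_sgd_measurable[OF assms])
  have [measurable]: "\<xi> t \<in> measurable M D"
    and ind: "indep_set (past M D x \<xi> t) {\<xi> t -` A \<inter> space M | A. A \<in> sets D}"
    using assms(1) by (auto simp: clip_sgd_def)
  interpret X: prob_space "distr M borel (x t)" by (rule prob_space_distr) simp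
  interpret Y: prob_space "distr M D (\<xi> t)" by (rule prob_space_distr) simp
  show ?thesis
  proof (rule pair_measure_eqI)
    fix A B assume A: "A \<in> sets (distr M borel (x t))" and B: "B \<in> sets (distr M D (\<xi> t))"
    \<comment> \<open>The past includes the iterate with index \<open>t\<close> itself but only
      samples with smaller index.\<close>
    have "x t -` A \<inter> space M \<in> past M D x \<xi> t"
      unfolding past_def using A by (intro sigma_sets.Basic) auto
    moreover have "\<xi> t -` B \<inter> space M \<in> {\<xi> t -` A \<inter> space M | A. A \<in> sets D}"
      using B by auto
    ultimately have "prob ((x t -` A \<inter> space M) \<inter> (\<xi> t -` B \<inter> space M))
        = prob (x t -` A \<inter> space M) * prob (\<xi> t -` B \<inter> space M)"
      by (rule indep_setD[OF ind])
    moreover have "(\<lambda>\<omega>. (x t \<omega>, \<xi> t \<omega>)) -` (A \<times> B) \<inter> space M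
        = (x t -` A \<inter> space M) \<inter> (\<xi> t -` B \<inter> space M)"
      by auto
    ultimately show "emeasure (distr M borel (x t)) A * emeasure (distr M D (\<xi> t)) B
        = emeasure (distr M (borel \<Otimes>\<^sub>M D) (\<lambda>\<omega>. (x t \<omega>, \<xi> t \<omega>))) (A \<times> B)"
      using A B by (simp add: emeasure_distr emeasure_eq_measure ennreal_mult)
  qed (simp_all add: X.sigma_finite_measure_axioms Y.sigma_finite_measure_axioms)
qed

section \<open>Conditional expectation with an independent variable\<close>

context prob_space
begin

text \<open>Events of the generated algebra are preimages under \<open>X\<close>, so their
  indicators depend on \<open>X\<close> alone. Tonelli for the product law then verifies the
  defining integral identity.\<close>

lemma nn_cond_exp_indep:
  assumes X [measurable]: "X \<in> measurable M S" and Y [measurable]: "Y \<in> measurable M T"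
    and joint: "distr M S X \<Otimes>\<^sub>M distr M T Y = distr M (S \<Otimes>\<^sub>M T) (\<lambda>\<omega>. (X \<omega>, Y \<omega>))"
    and H [measurable]: "H \<in> borel_measurable (S \<Otimes>\<^sub>M T)"
  shows "AE \<omega> in M. nn_cond_exp M (vimage_algebra (space M) X S) (\<lambda>\<omega>. H (X \<omega>, Y \<omega>)) \<omega>
    = (\<integral>\<^sup>+ y. H (X \<omega>, y) \<partial>distr M T Y)"
proof -
  define F where "F = vimage_algebra (space M) X S"
  have XF [measurable]: "X \<in> measurable F S"
    unfolding F_def using measurable_space[OF X] by (intro measurable_vimage_algebra1) auto
  have "subalgebra M F"
    unfolding subalgebra_def F_def
    using measurable_sets[OF X] measurable_space[OF X]
    by (auto simp: sets_vimage_algebra2 Pi_iff)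
  then interpret finite_measure_subalgebra M F
    by unfold_locales
  interpret Y: prob_space "distr M T Y" by (rule prob_space_distr) simp
  have H': "H \<in> borel_measurable (distr M S X \<Otimes>\<^sub>M distr M T Y)"
    by simp
  have int [measurable]: "(\<lambda>x. \<integral>\<^sup>+ y. H (x, y) \<partial>distr M T Y) \<in> borel_measurable S"
    using Y.borel_measurable_nn_integral_fst[of H S] H by simp
  have "AE \<omega> in M. (\<integral>\<^sup>+ y. H (X \<omega>, y) \<partial>distr M T Y) = nn_cond_exp M F (\<lambda>\<omega>. H (X \<omega>, Y \<omega>)) \<omega>"
  proof (rule nn_cond_exp_charact)
    fix A assume "A \<in> sets F"
    then obtain B where A: "A = X -` B \<inter> space M" and B [measurable]: "B \<in> sets S"
      using measurable_space[OF X] by (auto simp: F_def sets_vimage_algebra2 Pi_iff)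
    have ind: "indicator A \<omega> = (indicator B (X \<omega>) :: ennreal)" if "\<omega> \<in> space M" for \<omega>
      using that by (simp add: A indicator_def)
    have "(\<integral>\<^sup>+ \<omega>\<in>A. H (X \<omega>, Y \<omega>) \<partial>M) = (\<integral>\<^sup>+ \<omega>. H (X \<omega>, Y \<omega>) * indicator B (X \<omega>) \<partial>M)"
      using ind by (intro nn_integral_cong) simp
    also have "\<dots> = (\<integral>\<^sup>+ z. H z * indicator B (fst z) \<partial>distr M (S \<Otimes>\<^sub>M T) (\<lambda>\<omega>. (X \<omega>, Y \<omega>)))"
      by (subst nn_integral_distr) simp_all
    also have "\<dots> = (\<integral>\<^sup>+ x. \<integral>\<^sup>+ y. H (x, y) * indicator B x \<partial>distr M T Y \<partial>distr M S X)"
      unfolding joint[symmetric] by (subst Y.nn_integral_fst[symmetric]) simp_all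
    also have "\<dots> = (\<integral>\<^sup>+ x. (\<integral>\<^sup>+ y. H (x, y) \<partial>distr M T Y) * indicator B x \<partial>distr M S X)"
      by (intro nn_integral_cong nn_integral_multc) simp
    also have "\<dots> = (\<integral>\<^sup>+ \<omega>. (\<integral>\<^sup>+ y. H (X \<omega>, y) \<partial>distr M T Y) * indicator B (X \<omega>) \<partial>M)"
      by (subst nn_integral_distr) simp_all
    also have "\<dots> = (\<integral>\<^sup>+ \<omega>\<in>A. (\<integral>\<^sup>+ y. H (X \<omega>, y) \<partial>distr M T Y) \<partial>M)"
      using ind by (intro nn_integral_cong) simp
    finally show "(\<integral>\<^sup>+ \<omega>\<in>A. H (X \<omega>, Y \<omega>) \<partial>M)
        = (\<integral>\<^sup>+ \<omega>\<in>A. (\<integral>\<^sup>+ y. H (X \<omega>, y) \<partial>distr M T Y) \<partial>M)" .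
  qed measurable
  then show ?thesis
    by (auto simp: F_def)
qed

text \<open>Only the sections of \<open>H\<close> have to be integrable: \<^const>\<open>real_cond_exp\<close> is defined from
  the conditional expectations of the positive and negative parts.\<close>

lemma real_cond_exp_indep:
  fixes H :: "'b \<times> 'c \<Rightarrow> real"
  assumes X: "X \<in> measurable M S" and Y: "Y \<in> measurable M T"
    and joint: "distr M S X \<Otimes>\<^sub>M distr M T Y = distr M (S \<Otimes>\<^sub>M T) (\<lambda>\<omega>. (X \<omega>, Y \<omega>))"
    and H [measurable]: "H \<in> borel_measurable (S \<Otimes>\<^sub>M T)"
    and int: "\<And>x. x \<in> space S \<Longrightarrow> integrable (distr M T Y) (\<lambda>y. H (x, y))"
  shows "AE \<omega> in M. real_cond_exp M (vimage_algebra (space M) X S) (\<lambda>\<omega>. H (X \<omega>, Y \<omega>)) \<omega>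
    = (LINT y|distr M T Y. H (X \<omega>, y))"
proof -
  have "(\<lambda>z. ennreal (H z)) \<in> borel_measurable (S \<Otimes>\<^sub>M T)"
    and "(\<lambda>z. ennreal (- H z)) \<in> borel_measurable (S \<Otimes>\<^sub>M T)"
    by simp_all
  from this[THEN nn_cond_exp_indep[OF X Y joint]] AE_space show ?thesis
  proof eventually_elim
    case (elim \<omega>)
    then show ?case
      using int[OF measurable_space[OF X elim(3)]]
      by (simp add: real_cond_exp_def real_lebesgue_integral_def)
  qed
qed

end

theorem theorem1:
  fixes f :: "real ^ 'd \<Rightarrow> real"
    and L0 L1 c \<eta> \<sigma> :: real
    and M :: "'w measure"
    and D :: "'s measure"
    and g :: "real ^ 'd \<Rightarrow> 's \<Rightarrow> real ^ 'd"
    and \<xi> :: "nat \<Rightarrow> 'w \<Rightarrow> 's"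
    and x :: "nat \<Rightarrow> 'w \<Rightarrow> real ^ 'd"
  assumes smooth: "L0_L1_smooth L0 L1 f"
    and c: "c > 0"
    and eta: "\<eta> > 0"
    and sigma: "\<sigma> \<ge> 0"
    and iterates: "clip_sgd M D f c \<eta> \<sigma> g \<xi> x"
    and step: "\<eta> * (L0 + c * L1) \<le> 1"
  shows
    "let \<beta> = L0 + c * L1;
         \<alpha> = (\<lambda>t \<omega>. clip_factor c (gradient f (x t \<omega>)));
         \<epsilon>\<^sub>0 = 4 * min \<sigma> (\<sigma>\<^sup>2 / c);
         \<kappa> = \<epsilon>\<^sub>0 * min (\<epsilon>\<^sub>0 / 8) (2 * c)
     in (\<forall>t. AE \<omega> in M.
           real_cond_exp M (vimage_algebra (space M) (x t) borel) (\<lambda>\<omega>'. f (x (Suc t) \<omega>')) \<omega>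
             - f (x t \<omega>)
           \<le> - (\<eta> / 2) * (1 - \<eta> * \<beta>) * \<alpha> t \<omega> * (norm (gradient f (x t \<omega>)))\<^sup>2
              + \<eta>\<^sup>2 * \<beta> / 2 * min (\<sigma>\<^sup>2) (c\<^sup>2) + \<eta> * \<kappa>)
        \<and> \<kappa> \<le> 1 / 8 * \<epsilon>\<^sub>0\<^sup>2"
proof -
  interpret prob_space M using iterates by (simp add: clip_sgd_def)
  have sg: "stochastic_gradient D f \<sigma> g" and distr: "distr M D (\<xi> t) = D" for t
    using iterates by (auto simp: clip_sgd_def)
  have est: "clipped_estimate D (g y) (gradient f y) c \<sigma>" for y
    using sg c sigma
    by (auto simp: clipped_estimate_def clipped_estimate_axioms_def stochastic_gradient_def)
  have g: "(\<lambda>(y, s). g y s) \<in> borel_measurable (borel \<Otimes>\<^sub>M D)"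
    using sg by (simp add: stochastic_gradient_def)
  have f [measurable]: "f \<in> borel_measurable borel"
    using smooth by (intro borel_measurable_continuous_onI L0_L1_smooth_continuous_on)
  define H where "H z = f (fst z - \<eta> *\<^sub>R clip c (g (fst z) (snd z)))" for z
  have H: "H \<in> borel_measurable (borel \<Otimes>\<^sub>M D)"
  proof -
    have "(\<lambda>z. clip c (g (fst z) (snd z))) \<in> borel_measurable (borel \<Otimes>\<^sub>M D)"
      using measurable_compose[OF g borel_measurable_clip[OF c]] by (simp add: case_prod_beta)
    then show ?thesis unfolding H_def by measurable
  qed
  have int: "integrable D (\<lambda>s. H (y, s))" for y
  proof -
    interpret E: clipped_estimate D "g y" "gradient f y" c \<sigma> by (rule est)
    \<comment> \<open>Clipping confines the next point to this ball, where the continuous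
      \<open>f\<close> is bounded; hence each section of \<open>H\<close> is integrable.\<close>
    have "compact (f ` cball y (\<eta> * c))"
      using smooth by (intro compact_continuous_image L0_L1_smooth_continuous_on) auto
    then obtain b where b: "\<And>z. z \<in> cball y (\<eta> * c) \<Longrightarrow> norm (f z) \<le> b"
      by (meson bounded_iff compact_imp_bounded imageI)
    show ?thesis
    proof (rule E.integrable_const_bound[of _ b])
      have "norm (H (y, s)) \<le> b" for s
        using E.norm_clip_g[of s] eta unfolding H_def by (intro b) (simp add: dist_norm)
      then show "AE s in D. norm (H (y, s)) \<le> b" by simp
      show "(\<lambda>s. H (y, s)) \<in> borel_measurable D"
        unfolding H_def using E.measurable_clip_g by simp
    qed
  qed
  have "AE \<omega> in M. real_cond_exp M (vimage_algebra (space M) (x t) borel) (\<lambda>\<omega>'. f (x (Suc t) \<omega>')) \<omega>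
      - f (x t \<omega>)
      \<le> - (\<eta> / 2) * (1 - \<eta> * (L0 + c * L1)) * clip_factor c (gradient f (x t \<omega>))
          * (norm (gradient f (x t \<omega>)))\<^sup>2
        + \<eta>\<^sup>2 * (L0 + c * L1) / 2 * min (\<sigma>\<^sup>2) (c\<^sup>2) + \<eta> * bias_bound c \<sigma>" for t
  proof -
    define F where "F = vimage_algebra (space M) (x t) borel"
    have x: "x t \<in> borel_measurable M" for t by (rule clip_sgd_measurable[OF iterates c])
    have \<xi>: "\<xi> t \<in> measurable M D" using iterates by (simp add: clip_sgd_def)
    have "subalgebra M F"
      unfolding subalgebra_def F_def using measurable_sets[OF x]
      by (auto simp: sets_vimage_algebra2)
    then interpret finite_measure_subalgebra M F by unfold_locales
    \<comment> \<open>The recursion is given only on \<open>space M\<close>, so the conditional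
      expectations are matched almost everywhere.\<close>
    have next_eq: "f (x (Suc t) \<omega>) = H (x t \<omega>, \<xi> t \<omega>)" if "\<omega> \<in> space M" for \<omega>
      using iterates that by (simp add: clip_sgd_def H_def)
    have "AE \<omega> in M. real_cond_exp M F (\<lambda>\<omega>. f (x (Suc t) \<omega>)) \<omega>
        = real_cond_exp M F (\<lambda>\<omega>. H (x t \<omega>, \<xi> t \<omega>)) \<omega>"
    proof (rule real_cond_exp_cong)
      show "AE \<omega> in M. f (x (Suc t) \<omega>) = H (x t \<omega>, \<xi> t \<omega>)"
        using AE_space by eventually_elim (rule next_eq)
      show "(\<lambda>\<omega>. f (x (Suc t) \<omega>)) \<in> borel_measurable M"
        using measurable_compose[OF x f] .
      show "(\<lambda>\<omega>. H (x t \<omega>, \<xi> t \<omega>)) \<in> borel_measurable M"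
        using measurable_compose[OF measurable_Pair[OF x \<xi>] H] .
    qed
    moreover have "AE \<omega> in M. real_cond_exp M F (\<lambda>\<omega>. H (x t \<omega>, \<xi> t \<omega>)) \<omega> = (LINT s|D. H (x t \<omega>, s))"
      using real_cond_exp_indep[OF x \<xi> clip_sgd_joint_distr[OF iterates c] H] int by (simp add: distr F_def)
    ultimately show ?thesis
      unfolding F_def[symmetric]
    proof eventually_elim
      case (elim \<omega>)
      interpret E: clipped_estimate D "g (x t \<omega>)" "gradient f (x t \<omega>)" c \<sigma> by (rule est)
      show ?case
        using E.expected_clipped_descent[OF smooth eta step refl] int[of "x t \<omega>"] elim
        by (simp add: H_def)
    qed
  qed
  then show ?thesis
    using bias_bound_le[OF c sigma] unfolding bias_bound_def Let_def by blast
qed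

end
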